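(* Let $m,n$ be an admissible pair of positive integers, i.e. $m\ge n>1$, or $(m,n)=(2,1)$, or $(m,n)=(1,1)$. Then the determinant of the adjacency matrix of the suspension graph $S(m,n)$ is $$\det A(S(m,n)) = (-1)^{m+n}\bigl(4mn-5(m+n)+6\bigr).$$
   Context: For a simple graph $\Gamma$, $A(\Gamma)$ denotes its adjacency matrix. The complete bridge graph $B_{m,n}$ is the graph on $m+n$ vertices consisting of two vertex-disjoint complete graphs $K_m$ and $K_n$ joined by exactly one additional edge; the two endpoints of this edge are called the bridge vertices. The suspension graph $S(m,n)$ is the graph on $m+n+1$ vertices obtained from $B_{m,n}$ by adding one new vertex that is adjacent to every vertex of $B_{m,n}$ except the two bridge vertices. *)

theory Defs
  imports "Jordan_Normal_Form.Determinant"
begin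

record 'a sgraph =
  verts :: "'a set"
  edges :: "'a set set"

definition simple_graph :: "'a sgraph \<Rightarrow> bool" where
  "simple_graph G \<longleftrightarrow>
     finite (verts G) \<and> (\<forall>e \<in> edges G. e \<subseteq> verts G \<and> card e = 2)"

text \<open>The list \<open>vs\<close> fixes the order of the vertices, hence of the rows and columns;
  it is meant to enumerate the vertex set without repetition.\<close>

definition adj_matrix :: "'a sgraph \<Rightarrow> 'a list \<Rightarrow> int mat" where
  "adj_matrix G vs = mat (length vs) (length vs)
     (\<lambda>(i, j). if {vs ! i, vs ! j} \<in> edges G then 1 else 0)"

definition complete_graph :: "'a set \<Rightarrow> 'a sgraph" where
  "complete_graph V = \<lparr>verts = V, edges = {{u, v} |u v. u \<in> V \<and> v \<in> V \<and> u \<noteq> v}\<rparr>"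

text \<open>The cliques live on \<open>{0..<m}\<close> and \<open>{m..<m + n}\<close>; the bridge vertices are
  \<open>0\<close> and \<open>m\<close>. This is the intended graph for \<open>m, n \<ge> 1\<close> only.\<close>

definition complete_bridge_graph :: "nat \<Rightarrow> nat \<Rightarrow> nat sgraph" where
  "complete_bridge_graph m n =
     \<lparr>verts = verts (complete_graph {0..<m}) \<union> verts (complete_graph {m..<m + n}),
      edges = edges (complete_graph {0..<m}) \<union> edges (complete_graph {m..<m + n})
              \<union> {{0, m}}\<rparr>"

text \<open>The additional vertex is \<open>m + n\<close>.\<close>

definition suspension_graph :: "nat \<Rightarrow> nat \<Rightarrow> nat sgraph" where
  "suspension_graph m n =
     \<lparr>verts = insert (m + n) (verts (complete_bridge_graph m n)),
      edges = edges (complete_bridge_graph m n)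
              \<union> {{m + n, v} |v. v \<in> verts (complete_bridge_graph m n) - {0, m}}\<rparr>"

definition admissible :: "nat \<Rightarrow> nat \<Rightarrow> bool" where
  "admissible m n \<longleftrightarrow> (m \<ge> n \<and> n > 1) \<or> (m, n) = (2, 1) \<or> (m, n) = (1, 1)"

lemma verts_suspension_graph: "verts (suspension_graph m n) = {0..<m + n + 1}"
  by (auto simp: suspension_graph_def complete_bridge_graph_def complete_graph_def)

lemma simple_graph_suspension_graph:
  assumes "m \<ge> 1" "n \<ge> 1"
  shows "simple_graph (suspension_graph m n)"
  using assms
  by (auto simp: simple_graph_def suspension_graph_def complete_bridge_graph_def
      complete_graph_def card_2_iff doubleton_eq_iff)

end

theory Submission
  imports Defs
begin

text \<open>
  Write \<open>w\<close> for the added vertex, \<open>a\<close> and \<open>b\<close> for the bridge vertices, and \<open>a'\<close>, \<open>b'\<close> for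
  the sets of remaining vertices of the two cliques. Every two vertices of one class are
  adjacent, and two distinct classes are joined either completely or not at all: completely
  exactly when they are neighbours in the cyclic order \<open>w, a', a, b, b'\<close>. So \<open>S(m,n)\<close> is a
  five-cycle whose vertices are blown up to cliques of sizes \<open>1, m - 1, 1, 1, n - 1\<close>.

  The adjacency matrix plus the identity therefore only depends on classes: it factors as
  \<open>U V\<close> through a five-dimensional space, where \<open>U\<close> is the vertex-class incidence matrix. The
  exchange identity \<open>det (1 - U V) = det (1 - V U)\<close> (\<open>det_one_minus_mult_commute\<close>) replaces
  the determinant of order \<open>m + n + 1\<close> by one of order five, in which only the class
  sizes occur (\<open>det_blow_up\<close>); for this reason the result is the same for all enumerations
  of the vertices. With \<open>x = m - 1\<close> and \<open>y = n - 1\<close> the small determinant is \<open>x + y - 4 x y\<close>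
  (\<open>det_weighted_pentagon\<close>), and multiplying by \<open>(-1)^(m + n + 1)\<close> gives the formula.
  If \<open>n = 1\<close>, the class \<open>b'\<close> is empty and its column in the small matrix is a unit vector, so
  the same computation covers this case; likewise for \<open>m = 1\<close>.
\<close>

section \<open>Determinants of blow-ups\<close>

text \<open>Sylvester's determinant identity: the matrix with diagonal blocks \<open>1\<close> and
  off-diagonal blocks \<open>V\<close> and \<open>U\<close> can be made block triangular by clearing either
  off-diagonal block with column operations, and the two ways leave \<open>1 - U V\<close> and
  \<open>1 - V U\<close> on the diagonal.\<close>

lemma det_one_minus_mult_commute:
  fixes U V :: "'a :: idom mat"
  assumes U: "U \<in> carrier_mat n k" and V: "V \<in> carrier_mat k n"
  shows "det (1\<^sub>m n - U * V) = det (1\<^sub>m k - V * U)"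
proof -
  let ?M = "four_block_mat (1\<^sub>m k) V U (1\<^sub>m n)"
  let ?R = "four_block_mat (1\<^sub>m k) (- V) (0\<^sub>m n k) (1\<^sub>m n)"
  let ?L = "four_block_mat (1\<^sub>m k) (0\<^sub>m k n) (- U) (1\<^sub>m n)"
  have M: "?M \<in> carrier_mat (k + n) (k + n)" by simp
  have R: "?R \<in> carrier_mat (k + n) (k + n)" by simp
  have L: "?L \<in> carrier_mat (k + n) (k + n)" by simp
  have M_R: "?M * ?R = four_block_mat (1\<^sub>m k) (0\<^sub>m k n) U (1\<^sub>m n - U * V)"
    using U V by (subst mult_four_block_mat[of _ k k _ n _ n _ _ k _ n])
      (auto intro!: cong_four_block_mat)
  have M_L: "?M * ?L = four_block_mat (1\<^sub>m k - V * U) V (0\<^sub>m n k) (1\<^sub>m n)"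
    using U V by (subst mult_four_block_mat[of _ k k _ n _ n _ _ k _ n])
      (auto intro!: cong_four_block_mat)
  have "det ?R = 1"
    using V by (subst det_four_block_mat_lower_left_zero[of _ k _ n]) auto
  then have "det ?M = det (?M * ?R)" using det_mult[OF M R] by simp
  also have "\<dots> = det (1\<^sub>m n - U * V)"
    unfolding M_R using U V by (subst det_four_block_mat_upper_right_zero[of _ k _ n]) auto
  finally have 1: "det ?M = det (1\<^sub>m n - U * V)" .
  have "det ?L = 1"
    using U by (subst det_four_block_mat_upper_right_zero[of _ k _ n]) auto
  then have "det ?M = det (?M * ?L)" using det_mult[OF M L] by simp
  also have "\<dots> = det (1\<^sub>m k - V * U)"
    unfolding M_L using U V by (subst det_four_block_mat_lower_left_zero[of _ k _ n]) auto
  finally show ?thesis using 1 by simp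
qed

text \<open>For a 0/1 matrix \<open>B\<close> with unit diagonal, the left matrix is the adjacency matrix of the
  graph \<open>B\<close> with vertex \<open>b\<close> blown up to the clique \<open>{v. c v = b}\<close>. If \<open>U\<close> is the incidence matrix
  of vertices and classes and \<open>V\<close> consists of the columns of \<open>B\<close> repeated along the vertices,
  then this matrix is \<open>U V - 1\<close>, while in \<open>V U\<close> equal columns are summed, so that the class
  sizes appear as column weights.\<close>

lemma det_blow_up:
  fixes B :: "nat \<Rightarrow> nat \<Rightarrow> 'a :: idom" and c :: "'v \<Rightarrow> nat"
  assumes "distinct vs" and c: "\<And>v. v \<in> set vs \<Longrightarrow> c v < k"
  shows "det (mat (length vs) (length vs)
        (\<lambda>(i, j). B (c (vs ! i)) (c (vs ! j)) - (if i = j then 1 else 0)))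
    = (-1) ^ length vs * det (mat k k
        (\<lambda>(a, b). (if a = b then 1 else 0) - B a b * of_nat (card {v \<in> set vs. c v = b})))"
    (is "det ?A = _ * det ?Q")
proof -
  let ?N = "length vs"
  define U :: "'a mat" where "U = mat ?N k (\<lambda>(i, b). if c (vs ! i) = b then 1 else 0)"
  define V :: "'a mat" where "V = mat k ?N (\<lambda>(a, j). B a (c (vs ! j)))"
  have U: "U \<in> carrier_mat ?N k" and V: "V \<in> carrier_mat k ?N"
    by (simp_all add: U_def V_def)
  have UV: "?A = (-1) \<cdot>\<^sub>m (1\<^sub>m ?N - U * V)"
    using c by (intro eq_matI) (auto simp: U_def V_def scalar_prod_def if_distrib
        if_distribR sum.If_cases Int_def cong: if_cong)
  have "(\<Sum>i<?N. B a (c (vs ! i)) * (if c (vs ! i) = b then 1 else 0))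
      = B a b * of_nat (card {v \<in> set vs. c v = b})" for a b
  proof -
    have "(\<Sum>i<?N. B a (c (vs ! i)) * (if c (vs ! i) = b then 1 else 0))
        = (\<Sum>v\<in>set vs. B a (c v) * (if c v = b then 1 else 0))"
      using \<open>distinct vs\<close> by (intro sum.reindex_bij_betw bij_betw_nth) auto
    also have "\<dots> = (\<Sum>v\<in>{v \<in> set vs. c v = b}. B a b)"
      by (intro sum.mono_neutral_cong_right) auto
    finally show ?thesis by (simp add: mult.commute)
  qed
  then have VU: "?Q = 1\<^sub>m k - V * U"
    by (intro eq_matI) (auto simp: U_def V_def scalar_prod_def atLeast0LessThan)
  show ?thesis
    unfolding UV VU det_smult using U V by (simp add: det_one_minus_mult_commute[OF U V])
qed

section \<open>The weighted five-cycle\<close>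

text \<open>Adjacency in the five-cycle with a loop at each vertex: adjacent vertices of a blow-up
  may lie in the same class, and \<open>det_blow_up\<close> subtracts the identity again.\<close>

definition closed_pentagon :: "nat \<Rightarrow> nat \<Rightarrow> int" where
  "closed_pentagon a b = (if b = a \<or> b = Suc a mod 5 \<or> a = Suc b mod 5 then 1 else 0)"

text \<open>Laplace expansion along the first row, with the minors again in the form \<open>mat n n\<close>, so
  that it can be iterated by rewriting.\<close>

lemma det_mat_Suc:
  fixes f :: "nat \<times> nat \<Rightarrow> 'a :: comm_ring_1"
  shows "det (mat (Suc n) (Suc n) f) = (\<Sum>j<Suc n. f (0, j) * ((-1) ^ j *
    det (mat n n (\<lambda>(i, l). f (Suc i, if l < j then l else Suc l)))))"
proof -
  let ?F = "mat (Suc n) (Suc n) f"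
  have "mat_delete ?F 0 j = mat n n (\<lambda>(i, l). f (Suc i, if l < j then l else Suc l))" for j
    by (intro eq_matI) (auto simp: mat_delete_def)
  moreover have "det ?F = (\<Sum>j<Suc n. ?F $$ (0, j) * cofactor ?F 0 j)"
    by (rule laplace_expansion_row) auto
  ultimately show ?thesis by (simp add: cofactor_def)
qed

lemma closed_pentagon_table:
  "closed_pentagon a b = [[1, 1, 0, 0, 1], [1, 1, 1, 0, 0], [0, 1, 1, 1, 0],
    [0, 0, 1, 1, 1], [1, 0, 0, 1, 1]] ! a ! b" if "a < 5" "b < 5"
proof -
  have "a \<in> {0, 1, 2, 3, 4}" "b \<in> {0, 1, 2, 3, 4}" using that by auto
  then show ?thesis
    by (elim insertE emptyE; hypsubst) (simp_all add: closed_pentagon_def)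
qed

lemma det_weighted_pentagon:
  fixes s :: "nat \<Rightarrow> int"
  assumes "s 0 = 1" "s 1 = x" "s 2 = 1" "s 3 = 1" "s 4 = y"
  shows "det (mat 5 5 (\<lambda>(a, b). (if a = b then 1 else 0) - closed_pentagon a b * s b))
    = x + y - 4 * x * y"
proof -
  let ?rows = "[[0, - x, 0, 0, - y], [- 1, 1 - x, - 1, 0, 0], [0, - x, 0, - 1, 0],
    [0, 0, - 1, 0, - y], [- 1, 0, 0, - 1, 1 - y]]"
  have "(if a = b then 1 else 0) - closed_pentagon a b * s b = ?rows ! a ! b"
    if "a < 5" "b < 5" for a b
  proof -
    have "a \<in> {0, 1, 2, 3, 4}" "b \<in> {0, 1, 2, 3, 4}" using that by auto
    then show ?thesis using assms by (auto simp: closed_pentagon_table)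
  qed
  then have "mat 5 5 (\<lambda>(a, b). (if a = b then 1 else 0) - closed_pentagon a b * s b)
      = mat 5 5 (\<lambda>(a, b). ?rows ! a ! b)"
    by (intro cong_mat) auto
  also have "det \<dots> = x + y - 4 * x * y"
    \<comment> \<open>The entries are simplified only after the Laplace expansion is complete, since rewriting
      them under the binders of the minors makes the terms grow out of hand.\<close>
    apply (simp add: eval_nat_numeral)
    apply (simp only: det_mat_Suc sum.lessThan_Suc lessThan_0 sum.empty prod.case nth_Cons_0)
    apply simp
    apply (simp add: algebra_simps)
    done
  finally show ?thesis .
qed

section \<open>The suspension graph as a blow-up\<close>

text \<open>The numbering follows the cycle \<open>w, a', a, b, b'\<close>.\<close>

definition suspension_class :: "nat \<Rightarrow> nat \<Rightarrow> nat \<Rightarrow> nat" where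
  "suspension_class m n v =
     (if v = m + n then 0 else if v = 0 then 2 else if v < m then 1 else if v = m then 3 else 4)"

lemma edge_complete_graph_iff:
  "{u, v} \<in> edges (complete_graph W) \<longleftrightarrow> u \<in> W \<and> v \<in> W \<and> u \<noteq> v"
  by (auto simp: complete_graph_def doubleton_eq_iff)

lemma edge_suspension_graph_iff:
  "{u, v} \<in> edges (suspension_graph m n) \<longleftrightarrow>
    u < m \<and> v < m \<and> u \<noteq> v \<or>
    u \<in> {m..<m + n} \<and> v \<in> {m..<m + n} \<and> u \<noteq> v \<or>
    u = 0 \<and> v = m \<or> u = m \<and> v = 0 \<or>
    u = m + n \<and> v \<in> {0..<m + n} - {0, m} \<or> v = m + n \<and> u \<in> {0..<m + n} - {0, m}"
proof -
  let ?V = "verts (complete_bridge_graph m n)"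
  have V: "?V = {0..<m + n}"
    by (auto simp: complete_bridge_graph_def complete_graph_def)
  have "{u, v} \<in> {{m + n, w} |w. w \<in> ?V - {0, m}} \<longleftrightarrow>
      u = m + n \<and> v \<in> ?V - {0, m} \<or> v = m + n \<and> u \<in> ?V - {0, m}"
    by (auto simp: doubleton_eq_iff)
  moreover have "{u, v} \<in> edges (complete_bridge_graph m n) \<longleftrightarrow>
      {u, v} \<in> edges (complete_graph {0..<m}) \<or>
      {u, v} \<in> edges (complete_graph {m..<m + n}) \<or> {u, v} = {0, m}"
    by (simp add: complete_bridge_graph_def disj_ac)
  ultimately show ?thesis
    unfolding V edge_complete_graph_iff doubleton_eq_iff
    by (auto simp: suspension_graph_def V)
qed

text \<open>This is where the graph is recognised as a blow-up of the five-cycle.\<close>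

lemma adjacency_suspension_graph:
  assumes "m \<ge> 1" "n \<ge> 1" "u < m + n + 1" "v < m + n + 1"
  shows "(if {u, v} \<in> edges (suspension_graph m n) then 1 else 0)
    = closed_pentagon (suspension_class m n u) (suspension_class m n v)
      - (if u = v then 1 else 0)"
proof -
  have "w = m + n \<or> w = 0 \<or> 0 < w \<and> w < m \<or> w = m \<or> m < w \<and> w < m + n"
    if "w < m + n + 1" for w
    using that by linarith
  from this[OF assms(3)] this[OF assms(4)] show ?thesis
    unfolding edge_suspension_graph_iff
    using assms(1,2)
    by (elim disjE) (simp_all add: suspension_class_def closed_pentagon_table)
qed

lemma card_suspension_class:
  assumes "m \<ge> 1" "n \<ge> 1"
  defines "class_size \<equiv> \<lambda>b. int (card {v \<in> {0..<m + n + 1}. suspension_class m n v = b})"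
  shows "class_size 0 = 1" "class_size 1 = int m - 1" "class_size 2 = 1"
    "class_size 3 = 1" "class_size 4 = int n - 1"
proof -
  have "{v \<in> {0..<m + n + 1}. suspension_class m n v = 0} = {m + n}"
    "{v \<in> {0..<m + n + 1}. suspension_class m n v = 1} = {1..<m}"
    "{v \<in> {0..<m + n + 1}. suspension_class m n v = 2} = {0}"
    "{v \<in> {0..<m + n + 1}. suspension_class m n v = 3} = {m}"
    "{v \<in> {0..<m + n + 1}. suspension_class m n v = 4} = {Suc m..<m + n}"
    using assms(1,2) by (auto simp: suspension_class_def split: if_splits)
  then show "class_size 0 = 1" "class_size 1 = int m - 1" "class_size 2 = 1"
    "class_size 3 = 1" "class_size 4 = int n - 1"
    using assms(1,2) unfolding class_size_def by (simp_all add: of_nat_diff)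
qed

theorem theorem2p5:
  fixes m n :: nat and vs :: "nat list"
  assumes "admissible m n"
    and "distinct vs" and "set vs = verts (suspension_graph m n)"
  shows "det (adj_matrix (suspension_graph m n) vs)
    = (-1) ^ (m + n) * (4 * int m * int n - 5 * (int m + int n) + 6)"
proof -
  have pos: "m \<ge> 1" "n \<ge> 1" using assms(1) by (auto simp: admissible_def)
  have vs: "set vs = {0..<m + n + 1}" using assms(3) by (simp only: verts_suspension_graph)
  have len: "length vs = m + n + 1" using distinct_card[OF assms(2)] vs by simp
  let ?c = "suspension_class m n"
  have adj: "adj_matrix (suspension_graph m n) vs = mat (length vs) (length vs)
      (\<lambda>(i, j). closed_pentagon (?c (vs ! i)) (?c (vs ! j)) - (if i = j then 1 else 0))"
    unfolding adj_matrix_def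
  proof (intro cong_mat refl, clarify)
    fix i j assume ij: "i < length vs" "j < length vs"
    then have "vs ! i < m + n + 1" "vs ! j < m + n + 1"
      using vs nth_mem[of _ vs] by auto
    with adjacency_suspension_graph[OF pos this] ij
    show "(if {vs ! i, vs ! j} \<in> edges (suspension_graph m n) then 1 else 0)
      = closed_pentagon (?c (vs ! i)) (?c (vs ! j)) - (if i = j then 1 else 0)"
      by (simp add: nth_eq_iff_index_eq[OF assms(2)])
  qed
  have "det (adj_matrix (suspension_graph m n) vs)
    = (-1) ^ (m + n + 1) * det (mat 5 5 (\<lambda>(a, b). (if a = b then 1 else 0)
      - closed_pentagon a b * int (card {v \<in> {0..<m + n + 1}. ?c v = b})))"
    unfolding adj using det_blow_up[OF assms(2), of ?c 5 closed_pentagon]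
    by (simp only: vs len) (simp add: suspension_class_def)
  also have "\<dots> = (-1) ^ (m + n + 1)
      * ((int m - 1) + (int n - 1) - 4 * (int m - 1) * (int n - 1))"
    by (rule arg_cong[where f = "(*) _"], rule det_weighted_pentagon)
      (rule card_suspension_class[OF pos])+
  also have "\<dots> = (-1) ^ (m + n) * (4 * int m * int n - 5 * (int m + int n) + 6)"
    by (simp add: algebra_simps)
  finally show ?thesis .
qed

end
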